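(* Let $r\ge 0$ be an integer and let $S$ be the $(p,m,2)$ signed graph consisting of a positive edge, to which are attached $3$ positive pendant edges and $2$ negative pendant edges at one end as well as $r$ positive pendant edges at the other end. If $r$ is odd and $r\geq 7$ then $S$ is not additively graceful.
   Context: A signed graph $S$ is a finite simple graph on $p$ vertices in which $m$ edges are specified as positive and the remaining $n$ edges are specified as negative; it is then called a $(p,m,n)$ signed graph, with sets of positive and negative edges $E^+(S)$ and $E^-(S)$. Attaching a pendant edge at a vertex $z$ means adding a new vertex of degree 1 joined to $z$. Thus $S$ has positive edges $z_1z_2$, $z_1v_i$ ($1\le i\le 3$), $z_2w_i$ ($1\le i\le r$) and negative edges $z_1u_1$, $z_1u_2$, all these vertices being distinct, and no other vertices or edges. An additively graceful labeling of a $(p,m,n)$ signed graph $S=(V,E)$ is an injective map $f:V\to\{0,1,\dots,m+\lceil\frac{n+1}{2}\rceil\}$ such that, with $f^*(uv)=f(u)+f(v)$ for $uv\in E^-(S)$ and $f^*(uv)=|f(u)-f(v)|$ for $uv\in E^+(S)$, one has $\{f^*(uv):uv\in E^-(S)\}=\{1,2,\dots,n\}$ and $\{f^*(uv):uv\in E^+(S)\}=\{1,2,\dots,m\}$. $S$ is additively graceful if it admits such a labeling. *)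

theory Defs
  imports Complex_Main
begin

record 'a signed_graph =
  verts :: "'a set"
  pos_edges :: "'a set set"
  neg_edges :: "'a set set"

text \<open>An edge is an unordered pair, i.e. a two-element set of vertices; the underlying simple graph
  has edge set \<open>pos_edges S \<union> neg_edges S\<close>.\<close>

definition signed_graph :: "nat \<Rightarrow> nat \<Rightarrow> nat \<Rightarrow> 'a signed_graph \<Rightarrow> bool" where
  "signed_graph p m n S \<longleftrightarrow>
     finite (verts S) \<and> card (verts S) = p \<and>
     (\<forall>e \<in> pos_edges S \<union> neg_edges S. e \<subseteq> verts S \<and> card e = 2) \<and>
     pos_edges S \<inter> neg_edges S = {} \<and>
     card (pos_edges S) = m \<and> card (neg_edges S) = n"

text \<open>Labels are integers, so that \<open>f u - f v\<close> is a genuine difference.\<close>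

definition additively_graceful_labeling :: "'a signed_graph \<Rightarrow> ('a \<Rightarrow> int) \<Rightarrow> bool" where
  "additively_graceful_labeling S f \<longleftrightarrow>
     (let m = card (pos_edges S); n = card (neg_edges S) in
        inj_on f (verts S) \<and>
        f ` verts S \<subseteq> {0 .. int m + \<lceil>(real n + 1) / 2\<rceil>} \<and>
        {f u + f v | u v. {u, v} \<in> neg_edges S} = {1 .. int n} \<and>
        {\<bar>f u - f v\<bar> | u v. {u, v} \<in> pos_edges S} = {1 .. int m})"

definition additively_graceful :: "'a signed_graph \<Rightarrow> bool" where
  "additively_graceful S \<longleftrightarrow> (\<exists>f. additively_graceful_labeling S f)"

text \<open>A positive edge \<open>z\<^sub>1z\<^sub>2\<close> with 3 positive pendant edges \<open>z\<^sub>1v\<^sub>i\<close> and 2 negative pendant edges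
  \<open>z\<^sub>1u\<^sub>i\<close> attached at \<open>z\<^sub>1\<close>, and \<open>r\<close> positive pendant edges \<open>z\<^sub>2w\<^sub>i\<close> attached at \<open>z\<^sub>2\<close>. The
  description determines the graph up to isomorphism; the vertices may be of any type.\<close>

definition signed_double_broom :: "nat \<Rightarrow> 'a signed_graph \<Rightarrow> bool" where
  "signed_double_broom r S \<longleftrightarrow>
     (\<exists>z1 z2 u v w.
        distinct ([z1, z2] @ map u [1..<3] @ map v [1..<4] @ map w [1..<Suc r]) \<and>
        verts S = {z1, z2} \<union> u ` {1..2::nat} \<union> v ` {1..3::nat} \<union> w ` {1..r} \<and>
        pos_edges S = {{z1, z2}} \<union> (\<lambda>i. {z1, v i}) ` {1..3} \<union> (\<lambda>i. {z2, w i}) ` {1..r} \<and>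
        neg_edges S = (\<lambda>i. {z1, u i}) ` {1..2})"

lemma inj_on_doubleton: "inj_on (\<lambda>x. {a, x}) X"
  by (auto simp: inj_on_def doubleton_eq_iff)

lemma signed_graph_two_stars:
  assumes fin: "finite X" "finite U" "finite W"
    and disj: "z1 \<notin> X \<union> U \<union> W" "z2 \<in> X" "X \<inter> U = {}" "(X \<union> U) \<inter> W = {}"
  shows "signed_graph (1 + card X + card U + card W) (card X + card W) (card U)
    \<lparr>verts = {z1} \<union> X \<union> U \<union> W,
     pos_edges = (\<lambda>x. {z1, x}) ` X \<union> (\<lambda>x. {z2, x}) ` W,
     neg_edges = (\<lambda>x. {z1, x}) ` U\<rparr>"
proof -
  have z: "z1 \<noteq> z2" "z2 \<notin> W" using disj by blast+
  have zW: "z1 \<notin> e" if "e \<in> (\<lambda>x. {z2, x}) ` W" for e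
    using that z(1) disj(1) by auto
  have XW: "(\<lambda>x. {z1, x}) ` X \<inter> (\<lambda>x. {z2, x}) ` W = {}"
    using zW by (intro Int_emptyI) auto
  have UW: "(\<lambda>x. {z1, x}) ` U \<inter> (\<lambda>x. {z2, x}) ` W = {}"
    using zW by (intro Int_emptyI) auto
  have "(\<lambda>x. {z1, x}) ` X \<inter> (\<lambda>x. {z1, x}) ` U = {}"
    using disj(3) by (auto simp: doubleton_eq_iff)
  then have D: "((\<lambda>x. {z1, x}) ` X \<union> (\<lambda>x. {z2, x}) ` W) \<inter> (\<lambda>x. {z1, x}) ` U = {}"
    using UW by blast
  have cP: "card ((\<lambda>x. {z1, x}) ` X \<union> (\<lambda>x. {z2, x}) ` W) = card X + card W"
    using fin XW by (simp add: card_Un_disjoint card_image inj_on_doubleton)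
  have "card (X \<union> U \<union> W) = card X + card U + card W"
    using fin disj(3,4) by (simp add: card_Un_disjoint)
  moreover have "card (insert z1 (X \<union> U \<union> W)) = Suc (card (X \<union> U \<union> W))"
    using fin disj(1) by (intro card_insert_disjoint) auto
  ultimately have cV: "card ({z1} \<union> X \<union> U \<union> W) = 1 + card X + card U + card W"
    by simp
  have E: "\<forall>e \<in> (\<lambda>x. {z1, x}) ` X \<union> (\<lambda>x. {z2, x}) ` W \<union> (\<lambda>x. {z1, x}) ` U.
      e \<subseteq> {z1} \<union> X \<union> U \<union> W \<and> card e = 2"
  proof
    fix e assume "e \<in> (\<lambda>x. {z1, x}) ` X \<union> (\<lambda>x. {z2, x}) ` W \<union> (\<lambda>x. {z1, x}) ` U"
    then consider x where "e = {z1, x}" "x \<in> X \<union> U" | x where "e = {z2, x}" "x \<in> W"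
      by (elim UnE imageE) auto
    then show "e \<subseteq> {z1} \<union> X \<union> U \<union> W \<and> card e = 2"
    proof cases
      case (1 x)
      moreover from this have "z1 \<noteq> x" using disj(1) by blast
      ultimately show ?thesis by simp
    next
      case (2 x)
      moreover from this have "z2 \<noteq> x" using z(2) by blast
      ultimately show ?thesis using disj(2) by simp
    qed
  qed
  show ?thesis
    unfolding signed_graph_def signed_graph.simps
    using fin cV cP D E by (simp add: card_image inj_on_doubleton)
qed

lemma signed_double_broom_imp_signed_graph:
  assumes "signed_double_broom r S"
  shows "signed_graph (r + 7) (r + 4) 2 S"
proof -
  from assms obtain z1 z2 u v w where
    d: "distinct ([z1, z2] @ map u [1..<3] @ map v [1..<4] @ map w [1..<Suc r])"
    and V: "verts S = {z1, z2} \<union> u ` {1..2::nat} \<union> v ` {1..3::nat} \<union> w ` {1..r}"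
    and P: "pos_edges S = {{z1, z2}} \<union> (\<lambda>i. {z1, v i}) ` {1..3} \<union> (\<lambda>i. {z2, w i}) ` {1..r}"
    and N: "neg_edges S = (\<lambda>i. {z1, u i}) ` {1..2}"
    unfolding signed_double_broom_def by (elim exE conjE)
  let ?X = "insert z2 (v ` {1..3})" and ?U = "u ` {1..2}" and ?W = "w ` {1..r}"
  have sets: "{1..2} = set [1..<3]" "{1..3} = set [1..<4]" "{1..r} = set [1..<Suc r]"
    by auto
  have eq: "S = \<lparr>verts = {z1} \<union> ?X \<union> ?U \<union> ?W,
      pos_edges = (\<lambda>x. {z1, x}) ` ?X \<union> (\<lambda>x. {z2, x}) ` ?W,
      neg_edges = (\<lambda>x. {z1, x}) ` ?U\<rparr>"
  proof (rule signed_graph.equality)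
    show "verts S = verts \<lparr>verts = {z1} \<union> ?X \<union> ?U \<union> ?W,
        pos_edges = (\<lambda>x. {z1, x}) ` ?X \<union> (\<lambda>x. {z2, x}) ` ?W,
        neg_edges = (\<lambda>x. {z1, x}) ` ?U\<rparr>"
      unfolding V signed_graph.simps by blast
    show "signed_graph.more S = signed_graph.more \<lparr>verts = {z1} \<union> ?X \<union> ?U \<union> ?W,
        pos_edges = (\<lambda>x. {z1, x}) ` ?X \<union> (\<lambda>x. {z2, x}) ` ?W,
        neg_edges = (\<lambda>x. {z1, x}) ` ?U\<rparr>"
      by simp
  qed (simp_all only: P N signed_graph.simps image_insert image_image insert_is_Un[symmetric]
      Un_insert_left Un_empty_left)
  have facts: "z1 \<notin> insert z2 (?U \<union> (v ` {1..3} \<union> ?W))" "z2 \<notin> ?U \<union> (v ` {1..3} \<union> ?W)"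
    "?U \<inter> (v ` {1..3} \<union> ?W) = {}" "v ` {1..3} \<inter> ?W = {}"
    and inj: "inj_on u {1..2}" "inj_on v {1..3}" "inj_on w {1..r}"
    using d unfolding sets
    by (simp_all only: append.simps distinct.simps distinct_append distinct_map list.set
      set_append set_map simp_thms)
  have z1: "z1 \<notin> ?X \<union> ?U \<union> ?W" using facts(1) by blast
  have XU: "?X \<inter> ?U = {}" using facts(2,3) by blast
  have W: "(?X \<union> ?U) \<inter> ?W = {}" using facts(2-4) by blast
  have z2: "z2 \<notin> v ` {1..3}" using facts(2) by blast
  have "card ?X = 4" "card ?U = 2" "card ?W = r"
    using inj z2 by (simp_all add: card_image del: One_nat_def)
  then show ?thesis
    using signed_graph_two_stars[OF _ _ _ z1 _ XU W, of z2] eq by (simp add: add.commute)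
qed

lemma signed_double_broom_exists: "\<exists>S :: nat signed_graph. signed_double_broom r S"
proof -
  let ?u = "\<lambda>i::nat. i + 1" and ?v = "\<lambda>i::nat. i + 3" and ?w = "\<lambda>i::nat. i + 6"
  let ?S = "\<lparr>verts = {0, 1} \<union> ?u ` {1..2} \<union> ?v ` {1..3} \<union> ?w ` {1..r},
      pos_edges = {{0, 1}} \<union> (\<lambda>i. {0, ?v i}) ` {1..3} \<union> (\<lambda>i. {1, ?w i}) ` {1..r},
      neg_edges = (\<lambda>i. {0, ?u i}) ` {1..2}\<rparr>"
  have "distinct ([0, 1] @ map ?u [1..<3] @ map ?v [1..<4] @ map ?w [1..<Suc r])"
    by (auto simp: distinct_map inj_on_def simp del: upt_Suc)
  moreover have "verts ?S = {0, 1} \<union> ?u ` {1..2} \<union> ?v ` {1..3} \<union> ?w ` {1..r}"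
    "pos_edges ?S = {{0, 1}} \<union> (\<lambda>i. {0, ?v i}) ` {1..3} \<union> (\<lambda>i. {1, ?w i}) ` {1..r}"
    "neg_edges ?S = (\<lambda>i. {0, ?u i}) ` {1..2}"
    by (simp_all only: signed_graph.simps)
  ultimately have "signed_double_broom r ?S"
    unfolding signed_double_broom_def
    by (intro exI[of _ 0] exI[of _ 1] exI[of _ ?u] exI[of _ ?v] exI[of _ ?w] conjI)
  then show ?thesis ..
qed

end

theory Submission
  imports Defs
begin

text \<open>
  Write \<open>S\<close> for the graph, so \<open>m = r + 4\<close>, \<open>n = 2\<close>, and \<open>S\<close> has \<open>r + 7\<close> vertices. There are exactly
  \<open>r + 7\<close> admissible labels \<open>0, \<dots>, r + 6\<close>, so a labeling \<open>f\<close> uses each of them once. The negative sums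
  \<open>1\<close> and \<open>2\<close> force \<open>f z\<^sub>1 = 0\<close> and give the labels \<open>1, 2\<close> to \<open>u\<^sub>1, u\<^sub>2\<close>. Hence the labels
  \<open>3, \<dots>, r + 6\<close> are split among \<open>b = f z\<^sub>2\<close>, the set \<open>V\<close> of the three labels of the \<open>v\<^sub>i\<close>, and the set
  \<open>W\<close> of the labels of the \<open>w\<^sub>i\<close>; and since \<open>z\<^sub>1\<close> has label \<open>0\<close>, the positive edges carry the numbers in
  \<open>{b} \<union> V\<close> together with the distances \<open>\<bar>b - x\<bar>\<close> for \<open>x \<in> W\<close>.

  The theorem is thus a statement on integers, \<open>no_three_leaf_labels\<close> below. There are as many positive
  edges as values \<open>1, \<dots>, r + 4\<close>, so no value repeats. In particular \<open>b - d\<close> and \<open>b + d\<close> cannot both be in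
  \<open>W\<close>: if both lie in \<open>{3..r + 6}\<close>, one of them uses up an element of \<open>V\<close>. As \<open>V\<close> has three elements, \<open>b\<close>
  lies at distance at most \<open>3\<close> from an end of \<open>{3..r + 6}\<close>. For \<open>b = r + 4\<close>, the set \<open>V\<close> consists of
  \<open>r + 2\<close>, \<open>r + 3\<close> and a fixed point of \<open>x \<mapsto> r + 4 - x\<close>, which does not exist for odd \<open>r\<close>. For
  \<open>b = 3\<close>, the set \<open>V\<close> has to contain \<open>r + 4\<close>, \<open>r + 1\<close>, \<open>r - 2\<close>, and \<open>r - 5 = 3\<close>, so that
  \<open>r = 8\<close>. In the cases \<open>b \<in> {4, 5, 6, r + 3}\<close>, the large values and the small distances together ask for
  more elements of \<open>V\<close> than there are.
\<close>

section \<open>Splitting the labels \<open>3, \<dots>, r + 6\<close>\<close>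

lemma card_three_four_elements:
  assumes "card V = 3" "x1 \<in> V" "x2 \<in> V" "x3 \<in> V" "x4 \<in> V" "distinct [x1, x2, x3]"
  shows "x4 \<in> {x1, x2, x3}"
proof -
  have "{x1, x2, x3} = V"
    using assms by (intro card_seteq) (auto intro: card_ge_0_finite)
  then show ?thesis using assms by blast
qed

text \<open>By counting: \<open>W\<close> has \<open>r\<close> elements, so \<open>r + 4\<close> edges produce \<open>r + 4\<close> different values, and no two
  edges can share one.\<close>

lemma values_occur_once:
  fixes b r :: int
  assumes V: "card V = 3" "b \<notin> V" and r: "r \<ge> 0"
    and disj: "insert b V \<inter> W = {}"
    and labels: "insert b V \<union> W = {3..r + 6}"
    and vals: "insert b V \<union> (\<lambda>x. \<bar>b - x\<bar>) ` W = {1..r + 4}"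
  shows "inj_on (\<lambda>x. \<bar>b - x\<bar>) W" and "insert b V \<inter> (\<lambda>x. \<bar>b - x\<bar>) ` W = {}"
proof -
  let ?D = "(\<lambda>x. \<bar>b - x\<bar>) ` W"
  have fin: "finite (insert b V)" "finite W"
    using labels by (metis finite_Un finite_atLeastAtMost_int)+
  have X: "card (insert b V) = 4" using V fin by simp
  have "card (insert b V) + card W = card {3..r + 6}"
    using card_Un_disjoint[OF fin disj] labels by simp
  then have W: "card W = nat r" using X r by simp
  have D: "card ?D \<le> nat r" using card_image_le[OF fin(2), of "\<lambda>x. \<bar>b - x\<bar>"] W by simp
  have U: "card (insert b V) + card ?D = nat (r + 4) + card (insert b V \<inter> ?D)"
    using card_Un_Int[of "insert b V" ?D] fin vals by simp
  then have eq: "card ?D = nat r" "card (insert b V \<inter> ?D) = 0"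
    using X D r by linarith+
  show "inj_on (\<lambda>x. \<bar>b - x\<bar>) W" using eq_card_imp_inj_on fin(2) W eq(1) by metis
  show "insert b V \<inter> ?D = {}" using eq(2) fin by simp
qed

text \<open>Here \<open>b\<close> is the label of \<open>z\<^sub>2\<close>, and \<open>V\<close> and \<open>W\<close> are the labels of the positive leaves at \<open>z\<^sub>1\<close> and
  \<open>z\<^sub>2\<close>, after \<open>0\<close> was given to \<open>z\<^sub>1\<close>.\<close>

lemma no_three_leaf_labels:
  fixes b r :: int
  assumes V: "card V = 3" "b \<notin> V" and r: "odd r" "r \<ge> 7"
    and disj: "insert b V \<inter> W = {}"
    and labels: "insert b V \<union> W = {3..r + 6}"
    and vals: "insert b V \<union> (\<lambda>x. \<bar>b - x\<bar>) ` W = {1..r + 4}"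
  shows False
proof -
  have r0: "r \<ge> 0" using r by simp
  note once = values_occur_once[OF V r0 disj labels vals]
  note four = card_three_four_elements[OF V(1)]
  have X_range: "3 \<le> x \<and> x \<le> r + 4" if "x \<in> insert b V" for x
  proof -
    have "x \<in> {3..r + 6}" "x \<in> {1..r + 4}" using that labels vals by blast+
    then show ?thesis by simp
  qed
  have b: "3 \<le> b" "b \<le> r + 4" using X_range by simp_all
  have W_iff: "x \<in> W \<longleftrightarrow> 3 \<le> x \<and> x \<le> r + 6 \<and> x \<noteq> b \<and> x \<notin> V" for x
  proof -
    have "x \<in> insert b V \<union> W \<longleftrightarrow> x \<in> {3..r + 6}" using labels by simp
    then show ?thesis using disj by auto
  qed
  have dist_value: "\<bar>b - x\<bar> \<noteq> b \<and> \<bar>b - x\<bar> \<notin> V" if "x \<in> W" for x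
    using once(2) that by blast
  have near: "b - d \<in> V \<or> b + d \<in> V" if "1 \<le> d" "3 \<le> b - d" "b + d \<le> r + 6" for d
  proof (rule ccontr)
    assume "\<not> ?thesis"
    then have "b - d \<in> W" "b + d \<in> W" using that by (auto simp: W_iff)
    moreover have "\<bar>b - (b - d)\<bar> = \<bar>b - (b + d)\<bar>" by simp
    ultimately have "b - d = b + d" using inj_onD[OF once(1)] by blast
    then show False using that by simp
  qed
  have forced: "d \<in> V"
    if "1 \<le> d" "d \<le> r + 4" "d \<noteq> b" "b - d < 3 \<or> b - d \<in> V" "r + 6 < b + d \<or> b + d \<in> V" for d
  proof (rule ccontr)
    assume "d \<notin> V"
    moreover have "d \<in> insert b V \<union> (\<lambda>x. \<bar>b - x\<bar>) ` W" using that vals by simp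
    ultimately obtain x where x: "x \<in> W" "d = \<bar>b - x\<bar>" using \<open>d \<noteq> b\<close> by blast
    then have "x = b - d \<or> x = b + d" by linarith
    then show False using x(1) that by (auto simp: W_iff)
  qed
  have top: "r + 4 \<in> V" if "b \<noteq> r + 4"
    using that b by (intro forced) auto
  \<comment> \<open>Four distances at which both neighbours of \<open>b\<close> are labels would need four elements of \<open>V\<close>.\<close>
  have "b \<le> 6 \<or> r + 3 \<le> b"
  proof (rule ccontr)
    assume far: "\<not> ?thesis"
    have sub: "{1, 2, 3, 4} \<subseteq> (\<lambda>x. \<bar>b - x\<bar>) ` V"
    proof
      fix d :: int assume d: "d \<in> {1, 2, 3, 4}"
      then have "1 \<le> d" "d \<le> 4" by auto
      then have "b - d \<in> V \<or> b + d \<in> V" using near[of d] far by linarith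
      moreover have "d = \<bar>b - (b - d)\<bar>" "d = \<bar>b - (b + d)\<bar>" using \<open>1 \<le> d\<close> by simp_all
      ultimately show "d \<in> (\<lambda>x. \<bar>b - x\<bar>) ` V" by blast
    qed
    have "finite V" using V(1) by (metis card.infinite zero_neq_numeral)
    from card_mono[OF _ sub] card_image_le[OF this, of "\<lambda>x. \<bar>b - x\<bar>"] this V(1)
    show False by simp
  qed
  then consider "b = 3" | "b = 4" | "b = 5" | "b = 6" | "b = r + 3" | "b = r + 4"
    using b by linarith
  then show False
  proof cases
    case 1
    have v1: "r + 4 \<in> V" using top 1 r by simp
    \<comment> \<open>The distance \<open>d\<close> could only come from the label \<open>d + 3\<close>; if that is in \<open>V\<close>, then so is \<open>d\<close>.\<close>
    have v2: "r + 1 \<in> V" using v1 1 r by (intro forced) (auto simp: algebra_simps)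
    have v3: "r - 2 \<in> V" using v2 1 r by (intro forced) (auto simp: algebra_simps)
    have "r \<noteq> 8" using r(1) by auto
    then have v4: "r - 5 \<in> V" using v3 1 r by (intro forced) (auto simp: algebra_simps)
    from four[OF v1 v2 v3 v4] r show False by simp
  next
    case 2
    have v1: "r + 4 \<in> V" using top 2 r by simp
    have v2: "r + 3 \<in> V" using 2 r by (intro forced) auto
    have v3: "r \<in> V" using v1 2 r by (intro forced) (auto simp: algebra_simps)
    have "3 \<in> V \<or> 5 \<in> V" using near[of 1] 2 r by simp
    then show False using four[OF v1 v2 v3, of 3] four[OF v1 v2 v3, of 5] r by auto
  next
    case 3
    have v1: "r + 4 \<in> V" using top 3 r by simp
    have v2: "r + 3 \<in> V" using 3 r by (intro forced) auto
    have v3: "r + 2 \<in> V" using 3 r by (intro forced) auto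
    have "4 \<in> V \<or> 6 \<in> V" using near[of 1] 3 r by simp
    then show False using four[OF v1 v2 v3, of 4] four[OF v1 v2 v3, of 6] r by auto
  next
    case 4
    have v1: "r + 4 \<in> V" using top 4 r by simp
    have "5 \<in> V \<or> 7 \<in> V" "4 \<in> V \<or> 8 \<in> V" "3 \<in> V \<or> 9 \<in> V"
      using near[of 1] near[of 2] near[of 3] 4 r by simp_all
    then obtain x1 x2 x3 where x: "x1 \<in> V" "x2 \<in> V" "x3 \<in> V"
        "x1 \<in> {5, 7}" "x2 \<in> {4, 8}" "x3 \<in> {3, 9}"
      by blast
    then have "distinct [x1, x2, x3]" by auto
    from four[OF x(1-3) v1 this] x(4-6) r show False by auto
  next
    case 5
    have v1: "r + 4 \<in> V" using top 5 by simp
    have v2: "r + 2 \<in> V" using 5 r by (intro forced) auto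
    \<comment> \<open>Both of these are at distance \<open>1\<close>, which leaves one element of \<open>V\<close> for the distances \<open>2\<close> and \<open>3\<close>.\<close>
    have "r + 1 \<in> V \<or> r + 5 \<in> V" "r \<in> V \<or> r + 6 \<in> V"
      using near[of 2] near[of 3] 5 r by (simp_all add: algebra_simps)
    then obtain x2 x3 where x: "x2 \<in> V" "x3 \<in> V" "x2 \<in> {r + 1, r + 5}" "x3 \<in> {r, r + 6}"
      by blast
    then have "distinct [r + 4, r + 2, x2]" by auto
    from four[OF v1 v2 x(1,2) this] x(3,4) show False by auto
  next
    case 6
    \<comment> \<open>The labels \<open>r + 5\<close>, \<open>r + 6\<close> are too large for \<open>V\<close>, so they account for the distances \<open>1\<close>, \<open>2\<close>.\<close>
    have "r + 5 \<notin> V" "r + 6 \<notin> V" using X_range by force+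
    then have v: "r + 3 \<in> V" "r + 2 \<in> V" using near[of 1] near[of 2] 6 r by (auto simp: algebra_simps)
    have "finite V" using V(1) by (metis card.infinite zero_neq_numeral)
    then have "card (V - {r + 3, r + 2}) = 1" using v V(1) by (simp add: card_Diff_subset)
    then obtain s where s: "V - {r + 3, r + 2} = {s}" by (auto simp: card_1_singleton_iff)
    then have V_eq: "V = {r + 3, r + 2, s}" using v by blast
    have "s \<in> V" "s \<notin> {r + 3, r + 2}" using s by blast+
    moreover from this have "s \<noteq> b" using V(2) by blast
    ultimately have s_range: "3 \<le> s" "s \<le> r + 1" using X_range[of s] 6 by simp_all
    have "r + 4 - s \<noteq> s"
    proof
      assume "r + 4 - s = s"
      then have "r = 2 * (s - 2)" by simp
      then show False using r(1) by simp
    qed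
    \<comment> \<open>So the mirror image \<open>r + 4 - s\<close> of \<open>s\<close> is a label in \<open>W\<close>, at distance \<open>s\<close> from \<open>b\<close>.\<close>
    then have "r + 4 - s \<in> W" using s_range 6 unfolding W_iff V_eq by auto
    from dist_value[OF this] have "s \<notin> V" using 6 s_range by simp
    then show False using V_eq by blast
  qed
qed

section \<open>Reading the labels off the graph\<close>

lemma star_edge_values:
  assumes "\<And>x y. g x y = g y x"
  shows "{g x y | x y. {x, y} \<in> (\<lambda>x. {z, x}) ` X} = g z ` X"
proof -
  have "g x y \<in> g z ` X" if "{x, y} \<in> (\<lambda>x. {z, x}) ` X" for x y
  proof -
    from that obtain t where t: "t \<in> X" "{x, y} = {z, t}" by blast
    then have "x = z \<and> y = t \<or> x = t \<and> y = z" by (simp add: doubleton_eq_iff)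
    then have "g x y = g z t" using assms by metis
    then show ?thesis using t(1) by simp
  qed
  then show ?thesis by blast
qed

text \<open>If the label \<open>a\<close> of the centre of the negative star is not \<open>0\<close>, then it is \<open>1\<close>, and a leaf would
  repeat it; so \<open>a = 0\<close>.\<close>

lemma negative_star_labels:
  fixes a :: int
  assumes "(\<lambda>x. a + x) ` U = {1..2}" "a \<ge> 0" "\<forall>x\<in>U. x \<ge> 0" "a \<notin> U"
  shows "a = 0" "U = {1, 2}"
proof -
  have two: "{1..2::int} = {1, 2}" by auto
  obtain x y where x: "x \<in> U" "a + x = 1" and y: "y \<in> U" "a + y = 2"
    using assms(1) unfolding two by (metis imageE insertI1 insertI2)
  have "a \<le> 1" using x assms(3) by force
  moreover have "a \<noteq> 1" using y assms(4) by auto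
  ultimately show "a = 0" using assms(2) by simp
  then show "U = {1, 2}" using assms(1) two by simp
qed

theorem theorem4p12:
  fixes r :: nat and S :: "'a signed_graph"
  assumes "signed_double_broom r S"
    and "odd r" and "r \<ge> 7"
  shows "\<not> additively_graceful S"
proof
  assume "additively_graceful S"
  then obtain f where lab: "additively_graceful_labeling S f"
    unfolding additively_graceful_def ..
  have "signed_graph (r + 7) (r + 4) 2 S"
    by (rule signed_double_broom_imp_signed_graph[OF assms(1)])
  then have cards: "finite (verts S)" "card (verts S) = r + 7"
      "card (pos_edges S) = r + 4" "card (neg_edges S) = 2"
    unfolding signed_graph_def by auto
  have "\<lceil>(real 2 + 1) / 2\<rceil> = (2::int)" by (simp add: ceiling_eq_iff)
  with lab cards have inj: "inj_on f (verts S)"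
    and range: "f ` verts S \<subseteq> {0..int r + 6}"
    and neg: "{f x + f y | x y. {x, y} \<in> neg_edges S} = {1..2}"
    and pos: "{\<bar>f x - f y\<bar> | x y. {x, y} \<in> pos_edges S} = {1..int r + 4}"
    unfolding additively_graceful_labeling_def Let_def by (auto simp: algebra_simps)
  have onto: "f ` verts S = {0..int r + 6}"
    using range inj cards by (intro card_subset_eq) (auto simp: card_image)
  from assms(1) obtain z1 z2 u v w where
    d: "distinct ([z1, z2] @ map u [1..<3] @ map v [1..<4] @ map w [1..<Suc r])"
    and vS: "verts S = {z1, z2} \<union> u ` {1..2::nat} \<union> v ` {1..3::nat} \<union> w ` {1..r}"
    and pS: "pos_edges S = {{z1, z2}} \<union> (\<lambda>i. {z1, v i}) ` {1..3} \<union> (\<lambda>i. {z2, w i}) ` {1..r}"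
    and nS: "neg_edges S = (\<lambda>i. {z1, u i}) ` {1..2}"
    unfolding signed_double_broom_def by (elim exE conjE)
  define U X W where "U = u ` {1..2}" and "X = v ` {1..3}" and "W = w ` {1..r}"
  have sets: "{1..2} = set [1..<3]" "{1..3} = set [1..<4]" "{1..r} = set [1..<Suc r]"
    by auto
  have facts: "z1 \<notin> insert z2 (U \<union> (X \<union> W))" "z2 \<notin> U \<union> (X \<union> W)"
      "U \<inter> (X \<union> W) = {}" "X \<inter> W = {}" and inj_v: "inj_on v {1..3}"
    using d unfolding sets U_def X_def W_def
    by (simp_all only: append.simps distinct.simps distinct_append distinct_map list.set
      set_append set_map simp_thms)
  have verts: "verts S = {z1, z2} \<union> U \<union> X \<union> W" using vS unfolding U_def X_def W_def .
  have neg_star: "neg_edges S = (\<lambda>x. {z1, x}) ` U" using nS by (simp add: U_def image_image)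
  have pos_stars: "pos_edges S = (\<lambda>x. {z1, x}) ` insert z2 X \<union> (\<lambda>x. {z2, x}) ` W"
    using pS by (simp add: X_def W_def image_image)
  have disj_image: "f ` A \<inter> f ` B = {}" if "A \<subseteq> verts S" "B \<subseteq> verts S" "A \<inter> B = {}" for A B
    using inj_on_image_Int[OF inj that(1,2)] that(3) by simp
  have f_z1: "f z1 \<notin> f ` (insert z2 (U \<union> X \<union> W))"
    using disj_image[of "{z1}" "insert z2 (U \<union> X \<union> W)"] facts(1) verts by blast
  have f_z2: "f z2 \<notin> f ` (U \<union> X \<union> W)"
    using disj_image[of "{z2}" "U \<union> X \<union> W"] facts(2) verts by blast
  have f_U: "f ` U \<inter> f ` (X \<union> W) = {}" using disj_image[of U "X \<union> W"] facts(3) verts by blast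
  have f_XW: "f ` X \<inter> f ` W = {}" using disj_image[of X W] facts(4) verts by blast
  have nonneg: "f x \<ge> 0" if "x \<in> verts S" for x using range that by auto

  have "(\<lambda>x. f z1 + f x) ` U = {1..2}"
    using neg unfolding neg_star
    by (subst (asm) star_edge_values[of "\<lambda>x y. f x + f y"]) (simp_all add: add.commute)
  then have "(\<lambda>x. f z1 + x) ` (f ` U) = {1..2}" by (simp add: image_image)
  moreover have "f z1 \<ge> 0" "\<forall>x\<in>f ` U. x \<ge> 0" using nonneg verts by auto
  moreover have "f z1 \<notin> f ` U" using f_z1 by blast
  ultimately have z1: "f z1 = 0" and U: "f ` U = {1, 2}"
    by (rule negative_star_labels)+

  show False
  proof (rule no_three_leaf_labels[of "f ` X" "f z2" "int r" "f ` W"])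
    have "card X = 3" using inj_v by (simp add: X_def card_image)
    then show "card (f ` X) = 3"
      using card_image[of f X] inj_on_subset[OF inj, of X] verts by auto
    show "f z2 \<notin> f ` X" using f_z2 by blast
    show "odd (int r)" "int r \<ge> 7" using assms(2,3) by simp_all
    show "insert (f z2) (f ` X) \<inter> f ` W = {}" using f_z2 f_XW by blast
    have "{0..int r + 6} = {0, 1, 2} \<union> (insert (f z2) (f ` X) \<union> f ` W)"
      using onto z1 U unfolding verts by (auto simp: image_Un)
    moreover have "{0, 1, 2} \<inter> (insert (f z2) (f ` X) \<union> f ` W) = {}"
      using f_z1 f_z2 f_U unfolding z1 image_Un U by auto
    moreover have "C = A - B" if "A = B \<union> C" "B \<inter> C = {}" for A B C :: "int set"
      using that by blast
    ultimately have "insert (f z2) (f ` X) \<union> f ` W = {0..int r + 6} - {0, 1, 2}" by metis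
    also have "\<dots> = {3..int r + 6}" by auto
    finally show "insert (f z2) (f ` X) \<union> f ` W = {3..int r + 6}" .
    let ?g = "\<lambda>x y. \<bar>f x - f y\<bar>"
    have comm: "?g x y = ?g y x" for x y by (rule abs_minus_commute)
    have "{?g x y | x y. {x, y} \<in> pos_edges S} =
        {?g x y | x y. {x, y} \<in> (\<lambda>x. {z1, x}) ` insert z2 X}
        \<union> {?g x y | x y. {x, y} \<in> (\<lambda>x. {z2, x}) ` W}"
      unfolding pos_stars by blast
    also have "\<dots> = ?g z1 ` insert z2 X \<union> ?g z2 ` W"
      by (simp only: star_edge_values[of ?g, OF comm])
    finally have vals: "?g z1 ` insert z2 X \<union> ?g z2 ` W = {1..int r + 4}"
      unfolding pos by (rule sym)
    have "?g z1 x = f x" if "x \<in> insert z2 X" for x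
    proof -
      have "x \<in> verts S" using that verts by blast
      then show ?thesis using nonneg[of x] z1 by simp
    qed
    then have "?g z1 ` insert z2 X = f ` insert z2 X" by (rule image_cong[OF refl])
    then show "insert (f z2) (f ` X) \<union> (\<lambda>x. \<bar>f z2 - x\<bar>) ` f ` W = {1..int r + 4}"
      using vals by (simp only: image_insert image_image)
  qed
qed

end
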